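(* Let $G$ be a group that acts on a discrete median algebra $M$. If there exists a nonempty bounded $G$-subset of $M$, then there also exists a finite $G$-cube in $M$.
   Context: A median algebra is a nonempty set $M$ with a map $m: M^3\to M$ such that: $m(x,y,z)=m(x,z,y)=m(y,z,x)$; $m(x,x,y)=x$; $m(m(x,y,z),u,v)=m(x,m(y,u,v),m(z,u,v))$. Interval: $[x,y]=\{z: z=m(x,y,z)\}$. $C\subseteq M$ is convex if $[x,y]\subseteq C$ for all $x,y\in C$. A half space is a subset $H\subseteq M$ such that $H$ and $M\setminus H$ are both convex. $\Delta(x,y)$ is the set of half spaces containing $x$ but not $y$; $M$ is discrete if all $\Delta(x,y)$ are finite, and then $d(x,y)=|\Delta(x,y)|$ is a metric on $M$. Groups act by median automorphisms. A $G$-subset is a subset $B\subseteq M$ with $gB=B$ for all $g\in G$; it is bounded if it has finite diameter for $d$. A finite $G$-cube in $M$ is a finite convex $G$-subset $W\subseteq M$ which, as a median algebra, is isomorphic to the power set of a finite set (possibly empty, in which case $W$ is a single point) with the Boolean median $m(x,y,z)=(x\cap y)\cup(y\cap z)\cup(z\cap x)$. *)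

theory Defs
  imports "HOL-Algebra.Group_Action"
begin

locale median_algebra =
  fixes M :: "'a set" and m :: "'a \<Rightarrow> 'a \<Rightarrow> 'a \<Rightarrow> 'a"
  assumes nonempty: "M \<noteq> {}"
    and closed: "\<lbrakk>x \<in> M; y \<in> M; z \<in> M\<rbrakk> \<Longrightarrow> m x y z \<in> M"
    and swap: "\<lbrakk>x \<in> M; y \<in> M; z \<in> M\<rbrakk> \<Longrightarrow> m x y z = m x z y"
    and cycle: "\<lbrakk>x \<in> M; y \<in> M; z \<in> M\<rbrakk> \<Longrightarrow> m x y z = m y z x"
    and majority: "\<lbrakk>x \<in> M; y \<in> M\<rbrakk> \<Longrightarrow> m x x y = x"
    and distrib: "\<lbrakk>x \<in> M; y \<in> M; z \<in> M; u \<in> M; v \<in> M\<rbrakk>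
      \<Longrightarrow> m (m x y z) u v = m x (m y u v) (m z u v)"

definition median_interval :: "'a set \<Rightarrow> ('a \<Rightarrow> 'a \<Rightarrow> 'a \<Rightarrow> 'a) \<Rightarrow> 'a \<Rightarrow> 'a \<Rightarrow> 'a set" where
  "median_interval M m x y = {z \<in> M. z = m x y z}"

definition median_convex :: "'a set \<Rightarrow> ('a \<Rightarrow> 'a \<Rightarrow> 'a \<Rightarrow> 'a) \<Rightarrow> 'a set \<Rightarrow> bool" where
  "median_convex M m C \<longleftrightarrow> C \<subseteq> M \<and> (\<forall>x\<in>C. \<forall>y\<in>C. median_interval M m x y \<subseteq> C)"

definition half_space :: "'a set \<Rightarrow> ('a \<Rightarrow> 'a \<Rightarrow> 'a \<Rightarrow> 'a) \<Rightarrow> 'a set \<Rightarrow> bool" where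
  "half_space M m H \<longleftrightarrow> H \<subseteq> M \<and> median_convex M m H \<and> median_convex M m (M - H)"

definition separating_half_spaces ::
    "'a set \<Rightarrow> ('a \<Rightarrow> 'a \<Rightarrow> 'a \<Rightarrow> 'a) \<Rightarrow> 'a \<Rightarrow> 'a \<Rightarrow> 'a set set" where
  "separating_half_spaces M m x y = {H. half_space M m H \<and> x \<in> H \<and> y \<notin> H}"

locale discrete_median_algebra = median_algebra +
  assumes discrete: "\<lbrakk>x \<in> M; y \<in> M\<rbrakk> \<Longrightarrow> finite (separating_half_spaces M m x y)"

definition median_dist :: "'a set \<Rightarrow> ('a \<Rightarrow> 'a \<Rightarrow> 'a \<Rightarrow> 'a) \<Rightarrow> 'a \<Rightarrow> 'a \<Rightarrow> nat" where
  "median_dist M m x y = card (separating_half_spaces M m x y)"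

text \<open>Finite diameter; meaningful only when \<open>M\<close> is discrete, since otherwise \<open>card\<close>
  takes the value 0 on infinite sets.\<close>

definition median_bounded :: "'a set \<Rightarrow> ('a \<Rightarrow> 'a \<Rightarrow> 'a \<Rightarrow> 'a) \<Rightarrow> 'a set \<Rightarrow> bool" where
  "median_bounded M m B \<longleftrightarrow> B \<subseteq> M \<and> (\<exists>K. \<forall>x\<in>B. \<forall>y\<in>B. median_dist M m x y \<le> K)"

locale median_action = group_action G M \<phi> + median_algebra M m
  for G (structure) and M :: "'a set" and m :: "'a \<Rightarrow> 'a \<Rightarrow> 'a \<Rightarrow> 'a" and \<phi> +
  assumes automorphism: "\<lbrakk>g \<in> carrier G; x \<in> M; y \<in> M; z \<in> M\<rbrakk>
      \<Longrightarrow> \<phi> g (m x y z) = m (\<phi> g x) (\<phi> g y) (\<phi> g z)"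

definition G_subset :: "('g, 'r) monoid_scheme \<Rightarrow> 'a set \<Rightarrow> ('g \<Rightarrow> 'a \<Rightarrow> 'a) \<Rightarrow> 'a set \<Rightarrow> bool" where
  "G_subset G M \<phi> B \<longleftrightarrow> B \<subseteq> M \<and> (\<forall>g\<in>carrier G. \<phi> g ` B = B)"

definition median_isomorphic ::
    "'a set \<Rightarrow> ('a \<Rightarrow> 'a \<Rightarrow> 'a \<Rightarrow> 'a) \<Rightarrow> 'b set \<Rightarrow> ('b \<Rightarrow> 'b \<Rightarrow> 'b \<Rightarrow> 'b) \<Rightarrow> bool" where
  "median_isomorphic M m N n \<longleftrightarrow>
    (\<exists>f. bij_betw f M N \<and> (\<forall>x\<in>M. \<forall>y\<in>M. \<forall>z\<in>M. f (m x y z) = n (f x) (f y) (f z)))"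

definition boolean_median :: "'i set \<Rightarrow> 'i set \<Rightarrow> 'i set \<Rightarrow> 'i set" where
  "boolean_median x y z = (x \<inter> y) \<union> (y \<inter> z) \<union> (z \<inter> x)"

lemma median_algebra_Pow: "median_algebra (Pow I) boolean_median"
  by unfold_locales (auto simp: boolean_median_def)

text \<open>Taking the index set \<open>I\<close> among sets of natural numbers loses no generality, since every
  finite set is in bijection with one of these.\<close>

definition finite_G_cube ::
    "('g, 'r) monoid_scheme \<Rightarrow> 'a set \<Rightarrow> ('a \<Rightarrow> 'a \<Rightarrow> 'a \<Rightarrow> 'a) \<Rightarrow> ('g \<Rightarrow> 'a \<Rightarrow> 'a) \<Rightarrow> 'a set \<Rightarrow> bool"
where
  "finite_G_cube G M m \<phi> W \<longleftrightarrow>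
    finite W \<and> median_convex M m W \<and> G_subset G M \<phi> W \<and>
    (\<exists>I :: nat set. finite I \<and> median_isomorphic W m (Pow I) boolean_median)"

end

theory Submission
  imports Defs
begin

text \<open>The cube is found in two steps, both canonical and hence compatible with the group action.

The first step replaces the bounded set \<open>B\<close>, whose convex hull may be infinite and even unbounded,
by a finite invariant set: its centre \<open>C\<close>, the set of all points \<open>x\<close> for which the radius
\<open>max {d x b | b \<in> B}\<close> takes its smallest value \<open>R\<close>. It is finite (\<open>finite_centre\<close>) because
infinitely many points of \<open>C\<close> would have to leave some point \<open>z\<close> in infinitely many directions.
For each \<open>b \<in> B\<close>, only finitely many half spaces separate \<open>b\<close> from \<open>z\<close>, so some \<open>c \<in> C\<close> different
from \<open>z\<close> lies on the far side of \<open>z\<close> as seen from \<open>b\<close>; then \<open>d b z < d b c \<le> R\<close>, and \<open>z\<close> would have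
a radius less than \<open>R\<close>.

The second step compares the two sides of each half space by their depth. Only finitely many half
spaces split the finite set \<open>C\<close>, and the depth of \<open>H\<close> counts the half spaces inside \<open>H\<close> that meet
\<open>C\<close>. Depth is strictly monotone. Hence, if a choice of a side for some of the
splitting half spaces always takes a side at least as deep as its complement, and never both sides,
then the chosen sides intersect pairwise, so by Helly's theorem for convex sets they have a
common point (\<open>orientation_point\<close>). The set \<open>core C\<close> cut out by the strictly deeper sides, together
with the half spaces containing \<open>C\<close>, is therefore nonempty, and its points correspond to the
arbitrary choices of a side for each of the finitely many half spaces whose two sides are equally
deep (\<open>core_isomorphic_Pow\<close>). This makes it a cube.

Throughout, a point is identified with the set of half spaces that contain it. That this loses
nothing is \<open>half_space_separation\<close>: distinct points are separated by a half space.\<close>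

section \<open>Median identities\<close>

context median_algebra
begin

lemma comm12: "\<lbrakk>x \<in> M; y \<in> M; z \<in> M\<rbrakk> \<Longrightarrow> m x y z = m y x z"
  using cycle swap by metis

lemma majority': "\<lbrakk>x \<in> M; y \<in> M\<rbrakk> \<Longrightarrow> m x y x = x" "\<lbrakk>x \<in> M; y \<in> M\<rbrakk> \<Longrightarrow> m y x x = x"
  using majority swap cycle by metis+

lemma median_between:
  assumes "x \<in> M" "y \<in> M" "z \<in> M"
  shows "m x y (m x y z) = m x y z"
proof -
  have "m (m z x y) x y = m z (m x x y) (m y x y)"
    using assms by (intro distrib)
  then have "m (m z x y) x y = m z x y"
    using assms by (simp add: majority majority')
  then show ?thesis
    using assms by (metis closed cycle)
qed

text \<open>For a fixed base point \<open>r\<close>, the operation \<open>m r\<close> is the meet of a semilattice with least element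
\<open>r\<close>, in which \<open>x\<close> lies below \<open>y\<close> when \<open>x\<close> is between \<open>r\<close> and \<open>y\<close>. In this order
\<open>m r a u\<close> is the least element of the interval between \<open>a\<close> and \<open>u\<close>, that is, its point nearest
to \<open>r\<close>.\<close>

lemma median_gate:
  assumes "a \<in> M" "u \<in> M" "p \<in> M" "r \<in> M" and p: "p = m a u p"
  shows "m r p (m r a u) = m r a u"
proof -
  have "m (m r p r) a u = m r (m p a u) (m r a u)"
    using assms by (intro distrib)
  then show ?thesis
    using assms by (metis majority' cycle)
qed

lemma meet_assoc:
  assumes "x \<in> M" "y \<in> M" "z \<in> M" "r \<in> M"
  shows "m r (m r x y) z = m r x (m r y z)"
proof -
  have "m (m x r y) r z = m x (m r r z) (m y r z)"
    using assms by (intro distrib)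
  then have "m (m x r y) r z = m x r (m y r z)"
    using assms by (simp add: majority)
  then show ?thesis
    using assms by (metis closed comm12)
qed

text \<open>In the semilattice based at \<open>r\<close>, the meets of \<open>a\<close> and of \<open>b\<close> with \<open>u\<close> lie below \<open>p\<close> and \<open>q\<close>,
whose meet is \<open>r\<close>; so they meet in \<open>r\<close>, and distributivity turns this into the conclusion.
This identity makes the union of the intervals from a convex set to a point convex.\<close>

lemma join_interval:
  assumes M: "a \<in> M" "b \<in> M" "u \<in> M" "p \<in> M" "q \<in> M" "r \<in> M"
    and p: "p = m a u p" and q: "q = m b u q" and r: "r = m p q r"
  shows "r = m (m a b r) u r"
proof -
  let ?s = "m r a u" and ?t = "m r b u"
  have st: "?s \<in> M" "?t \<in> M" using M by (auto intro: closed)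
  have "m r ?s ?t = m r (m r p ?s) (m r q ?t)"
    using M p q by (simp add: median_gate)
  also have "\<dots> = m r (m r p q) (m r ?s ?t)"
    using M st by (metis closed meet_assoc swap)
  also have "m r p q = r"
    using M r by (metis cycle)
  also have "m r r (m r ?s ?t) = r"
    using M st by (auto intro: majority closed)
  finally have "m r ?s ?t = r" .
  moreover have "m (m r a b) u r = m r (m a u r) (m b u r)"
    using M by (intro distrib)
  ultimately show ?thesis
    using M by (metis cycle)
qed

text \<open>In the semilattice based at \<open>y\<close>, the meet of \<open>a\<close> and \<open>b\<close> has meet \<open>y\<close> with both \<open>u\<close> and \<open>v\<close>, hence
also with \<open>w\<close>, which lies between them. This is what makes the complement of a maximal convex set
convex in \<open>half_space_separation\<close>.\<close>

lemma separate_interval: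
  assumes M: "a \<in> M" "b \<in> M" "u \<in> M" "v \<in> M" "w \<in> M" "y \<in> M"
    and u: "y = m a u y" and v: "y = m b v y" and w: "w = m u v w"
  shows "y = m w (m a b y) y"
proof -
  let ?s = "m y a b"
  have s: "?s \<in> M" using M by (auto intro: closed)
  have "m y u a = y" "m y v b = y" using M u v by (metis cycle swap)+
  then have us: "m y u ?s = y" and vs: "m y v ?s = y"
    using M by (metis closed majority meet_assoc swap)+
  have "m (m w u v) ?s y = m w (m u ?s y) (m v ?s y)"
    using M s by (intro distrib)
  also have "m u ?s y = y" using us M s by (metis cycle)
  also have "m v ?s y = y" using vs M s by (metis cycle)
  also have "m w y y = y" using M by (simp add: majority')
  finally have "m (m w u v) ?s y = y" .
  then show ?thesis using M w s by (metis cycle)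
qed

section \<open>Half spaces separate points\<close>

lemma convexD:
  assumes "median_convex M m C" "x \<in> C" "y \<in> C" "z \<in> M"
  shows "m x y z \<in> C"
proof -
  have "x \<in> M" "y \<in> M" using assms by (auto simp: median_convex_def)
  then have "m x y z \<in> median_interval M m x y"
    using assms by (simp add: median_interval_def median_between closed)
  then show ?thesis using assms by (auto simp: median_convex_def)
qed

lemma convexD':
  assumes "median_convex M m C" "x \<in> C" "y \<in> C" "z \<in> M"
  shows "m x z y \<in> C" "m z x y \<in> C"
proof -
  have "x \<in> M" "y \<in> M" using assms by (auto simp: median_convex_def)
  then show "m x z y \<in> C" "m z x y \<in> C"
    using convexD[OF assms] assms by (metis swap, metis cycle)
qed

lemma convex_join:
  assumes A: "median_convex M m A" and u: "u \<in> M"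
  shows "median_convex M m (\<Union>a\<in>A. median_interval M m a u)"
  unfolding median_convex_def
proof (intro conjI ballI subsetI)
  fix p q r
  assume p: "p \<in> (\<Union>a\<in>A. median_interval M m a u)"
    and q: "q \<in> (\<Union>a\<in>A. median_interval M m a u)"
    and r: "r \<in> median_interval M m p q"
  from p obtain a where a: "a \<in> A" "p \<in> M" "p = m a u p" by (auto simp: median_interval_def)
  from q obtain b where b: "b \<in> A" "q \<in> M" "q = m b u q" by (auto simp: median_interval_def)
  have r': "r \<in> M" "r = m p q r" using r by (auto simp: median_interval_def)
  have ab: "a \<in> M" "b \<in> M" using a b A by (auto simp: median_convex_def)
  have "r = m (m a b r) u r"
    by (rule join_interval[where p = p and q = q]) (use a b r' ab u in auto)
  moreover have "m a b r \<in> A" using convexD[OF A a(1) b(1) r'(1)] .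
  ultimately show "r \<in> (\<Union>a\<in>A. median_interval M m a u)"
    using r' by (auto simp: median_interval_def)
qed (auto simp: median_interval_def)

text \<open>A convex set maximal among those containing \<open>x\<close> but not \<open>y\<close> is a half space. By maximality, every
\<open>u\<close> outside it sees \<open>y\<close> on an interval from the set to \<open>u\<close>. If \<open>u\<close> and \<open>v\<close> are outside and some
\<open>w\<close> between them is inside, then \<open>separate_interval\<close> puts \<open>y\<close> between two points of the set.\<close>

theorem half_space_separation:
  assumes x: "x \<in> M" and y: "y \<in> M" and "x \<noteq> y"
  obtains H where "half_space M m H" "x \<in> H" "y \<notin> H"
proof -
  define \<A> where "\<A> = {A. median_convex M m A \<and> x \<in> A \<and> y \<notin> A}"
  have "\<exists>A\<in>\<A>. \<forall>X\<in>\<A>. A \<subseteq> X \<longrightarrow> X = A"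
  proof (rule subset_Zorn_nonempty)
    have "{x} \<in> \<A>"
      using x \<open>x \<noteq> y\<close> by (auto simp: \<A>_def median_convex_def median_interval_def majority)
    then show "\<A> \<noteq> {}" by blast
    show "\<Union>\<C> \<in> \<A>" if "\<C> \<noteq> {}" and chain: "subset.chain \<A> \<C>" for \<C>
    proof -
      have sub: "\<And>A. A \<in> \<C> \<Longrightarrow> A \<in> \<A>" using chain by (auto simp: subset.chain_def)
      have "median_convex M m (\<Union>\<C>)"
        unfolding median_convex_def
      proof (intro conjI ballI)
        show "\<Union>\<C> \<subseteq> M"
          using sub unfolding \<A>_def median_convex_def by blast
        fix p q assume "p \<in> \<Union>\<C>" "q \<in> \<Union>\<C>"
        then obtain A B where AB: "A \<in> \<C>" "p \<in> A" "B \<in> \<C>" "q \<in> B" by blast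
        then have "A \<subseteq> B \<or> B \<subseteq> A"
          using chain unfolding subset_chain_def by blast
        then obtain C where C: "C \<in> \<C>" "p \<in> C" "q \<in> C" using AB by blast
        then have "median_interval M m p q \<subseteq> C"
          using sub unfolding \<A>_def median_convex_def by auto
        then show "median_interval M m p q \<subseteq> \<Union>\<C>" using C by blast
      qed
      then show ?thesis using \<open>\<C> \<noteq> {}\<close> sub by (auto simp: \<A>_def)
    qed
  qed
  then obtain A where A: "median_convex M m A" "x \<in> A" "y \<notin> A"
    and max: "\<And>X. \<lbrakk>median_convex M m X; x \<in> X; y \<notin> X; A \<subseteq> X\<rbrakk> \<Longrightarrow> X = A"
    by (auto simp: \<A>_def)
  have AM: "A \<subseteq> M" using A by (auto simp: median_convex_def)
  have join: "\<exists>a\<in>A. y = m a u y" if u: "u \<in> M - A" for u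
  proof (rule ccontr)
    assume none: "\<not> (\<exists>a\<in>A. y = m a u y)"
    let ?J = "\<Union>a\<in>A. median_interval M m a u"
    have "y \<notin> ?J" using none by (auto simp: median_interval_def)
    moreover have "A \<subseteq> ?J" "u \<in> ?J"
      using AM u A(2) by (force simp: median_interval_def majority')+
    ultimately have "?J = A"
      using A u by (intro max convex_join) auto
    then show False using \<open>u \<in> ?J\<close> u by blast
  qed
  have "median_convex M m (M - A)"
    unfolding median_convex_def
  proof (intro conjI ballI subsetI)
    fix u v w assume u: "u \<in> M - A" and v: "v \<in> M - A" and w: "w \<in> median_interval M m u v"
    from join[OF u] obtain a where a: "a \<in> A" "y = m a u y" by blast
    from join[OF v] obtain b where b: "b \<in> A" "y = m b v y" by blast
    have w': "w \<in> M" "w = m u v w" using w by (auto simp: median_interval_def)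
    have yw: "y = m w (m a b y) y"
      by (rule separate_interval[where u = u and v = v]) (use a b w' u v y AM in auto)
    have "m a b y \<in> A" using A(1) a(1) b(1) y by (rule convexD)
    then have "w \<notin> A" using convexD[OF A(1) _ _ y, of w "m a b y"] A(3) yw by auto
    then show "w \<in> M - A" using w' by blast
  qed auto
  then have "half_space M m A" using A(1) AM by (simp add: half_space_def)
  then show thesis using A(2,3) that by blast
qed

lemma half_space_compl: "half_space M m H \<Longrightarrow> half_space M m (M - H)"
  by (auto simp: half_space_def double_diff)

lemma half_space_subset: "half_space M m H \<Longrightarrow> H \<subseteq> M"
  by (simp add: half_space_def)

text \<open>Sending a point to the set of half spaces that contain it turns the median into the Boolean
median: two of the three points lie on the same side of \<open>H\<close>, and convexity of that side forces the
median to be there too.\<close>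

lemma half_space_median_iff:
  assumes H: "half_space M m H" and M: "x \<in> M" "y \<in> M" "z \<in> M"
  shows "m x y z \<in> H \<longleftrightarrow> x \<in> H \<and> y \<in> H \<or> y \<in> H \<and> z \<in> H \<or> z \<in> H \<and> x \<in> H"
proof -
  have two: "m x y z \<in> K"
    if "half_space M m K" "x \<in> K \<and> y \<in> K \<or> y \<in> K \<and> z \<in> K \<or> z \<in> K \<and> x \<in> K" for K
  proof -
    have "median_convex M m K" using that by (simp add: half_space_def)
    note K = convexD[OF this] convexD'[OF this]
    show ?thesis using that(2) M by (elim disjE conjE) (simp_all add: K)
  qed
  show ?thesis
    using two[OF H] two[OF half_space_compl[OF H]] M by blast
qed

lemma half_spaces_eqI:
  assumes "x \<in> M" "y \<in> M" "\<And>H. half_space M m H \<Longrightarrow> x \<in> H \<Longrightarrow> y \<in> H"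
  shows "x = y"
  using half_space_separation assms by metis

lemma interval_iff_half_spaces:
  assumes "x \<in> M" "y \<in> M" "z \<in> M"
  shows "z = m x y z \<longleftrightarrow> (\<forall>H. half_space M m H \<longrightarrow> x \<in> H \<longrightarrow> y \<in> H \<longrightarrow> z \<in> H)"
proof
  assume "z = m x y z"
  then show "\<forall>H. half_space M m H \<longrightarrow> x \<in> H \<longrightarrow> y \<in> H \<longrightarrow> z \<in> H"
    using half_space_median_iff assms by metis
next
  assume *: "\<forall>H. half_space M m H \<longrightarrow> x \<in> H \<longrightarrow> y \<in> H \<longrightarrow> z \<in> H"
  show "z = m x y z"
  proof (rule sym, rule half_spaces_eqI)
    fix H assume "half_space M m H" "m x y z \<in> H"
    then show "z \<in> H" using half_space_median_iff[of H x y z] * assms by blast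
  qed (use assms closed in auto)
qed

text \<open>The median of one point from each pairwise intersection lies in all three sets, because each
of the sets contains two of these points.\<close>

lemma Helly3:
  assumes "median_convex M m X" "median_convex M m Y" "median_convex M m Z"
    and "X \<inter> Y \<noteq> {}" "Y \<inter> Z \<noteq> {}" "Z \<inter> X \<noteq> {}"
  shows "X \<inter> Y \<inter> Z \<noteq> {}"
proof -
  obtain x y z where "x \<in> X \<inter> Y" "y \<in> Y \<inter> Z" "z \<in> Z \<inter> X" using assms by blast
  moreover from this have "x \<in> M" "y \<in> M" "z \<in> M" using assms by (auto simp: median_convex_def)
  ultimately have "m x y z \<in> X \<inter> Y \<inter> Z"
    using convexD convexD' assms by auto
  then show ?thesis by blast
qed

lemma convex_Int:
  "median_convex M m X \<Longrightarrow> median_convex M m Y \<Longrightarrow> median_convex M m (X \<inter> Y)"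
  unfolding median_convex_def by blast

text \<open>The set \<open>Q\<close> is kept apart from the family because the induction absorbs the members into it one by
one; \<open>Helly3\<close> shows that the smaller \<open>Q\<close> still meets the remaining members.\<close>

lemma Helly:
  assumes "finite \<F>" "median_convex M m Q" "Q \<noteq> {}"
    and "\<And>X. X \<in> \<F> \<Longrightarrow> median_convex M m X"
    and "\<And>X. X \<in> \<F> \<Longrightarrow> Q \<inter> X \<noteq> {}"
    and "\<And>X Y. X \<in> \<F> \<Longrightarrow> Y \<in> \<F> \<Longrightarrow> X \<inter> Y \<noteq> {}"
  shows "Q \<inter> \<Inter>\<F> \<noteq> {}"
  using assms
proof (induction \<F> arbitrary: Q rule: finite_induct)
  case (insert X \<F>)
  note conv = insert.prems(3) and meetQ = insert.prems(4) and meet = insert.prems(5)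
  have "(Q \<inter> X) \<inter> \<Inter>\<F> \<noteq> {}"
  proof (rule insert.IH)
    show "median_convex M m (Q \<inter> X)"
      using insert.prems(1) conv[of X] by (simp add: convex_Int)
    show "Q \<inter> X \<noteq> {}" by (rule meetQ) simp
  next
    fix Y assume Y: "Y \<in> \<F>"
    show "Q \<inter> X \<inter> Y \<noteq> {}"
    proof (rule Helly3)
      show "Y \<inter> Q \<noteq> {}" using meetQ[of Y] Y by (simp add: Int_commute)
    qed (use insert.prems(1) conv meetQ meet Y in simp_all)
    show "median_convex M m Y" using conv Y by simp
  next
    fix Y Z assume "Y \<in> \<F>" "Z \<in> \<F>"
    then show "Y \<inter> Z \<noteq> {}" by (intro meet) simp_all
  qed
  then show ?case by (simp add: Int_assoc)
qed simp

end

section \<open>The metric and the centre of a bounded set\<close>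

context discrete_median_algebra
begin

lemma dist_sym:
  assumes "x \<in> M" "y \<in> M"
  shows "median_dist M m x y = median_dist M m y x"
proof -
  have "bij_betw (\<lambda>H. M - H) (separating_half_spaces M m x y) (separating_half_spaces M m y x)"
    by (rule bij_betwI[where g = "\<lambda>H. M - H"])
      (use assms half_space_compl in
        \<open>auto simp: separating_half_spaces_def half_space_def double_diff\<close>)
  then show ?thesis by (simp add: median_dist_def bij_betw_same_card)
qed

lemma dist_between:
  assumes "x \<in> M" "y \<in> M" "z \<in> M" "z = m x y z"
  shows "median_dist M m x y = median_dist M m x z + median_dist M m z y"
proof -
  have "separating_half_spaces M m x y
      = separating_half_spaces M m x z \<union> separating_half_spaces M m z y"
    using half_space_median_iff[of _ x y z] assms
    by (auto simp: separating_half_spaces_def)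
  moreover have "separating_half_spaces M m x z \<inter> separating_half_spaces M m z y = {}"
    by (auto simp: separating_half_spaces_def)
  ultimately show ?thesis
    using discrete assms(1-3) by (simp add: median_dist_def card_Un_disjoint)
qed

lemma dist_triangle:
  assumes "x \<in> M" "y \<in> M" "z \<in> M"
  shows "median_dist M m x y \<le> median_dist M m x z + median_dist M m z y"
proof -
  have "separating_half_spaces M m x y
      \<subseteq> separating_half_spaces M m x z \<union> separating_half_spaces M m z y"
    by (auto simp: separating_half_spaces_def)
  then have "median_dist M m x y
      \<le> card (separating_half_spaces M m x z \<union> separating_half_spaces M m z y)"
    unfolding median_dist_def using discrete assms by (intro card_mono) auto
  also have "\<dots> \<le> median_dist M m x z + median_dist M m z y"
    unfolding median_dist_def by (rule card_Un_le)
  finally show ?thesis .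
qed

lemma dist_pos:
  assumes "x \<in> M" "y \<in> M" "x \<noteq> y"
  shows "median_dist M m x y > 0"
proof -
  have "separating_half_spaces M m x y \<noteq> {}"
    using half_space_separation[OF assms] by (auto simp: separating_half_spaces_def)
  then show ?thesis using discrete assms by (simp add: median_dist_def card_gt_0_iff)
qed

text \<open>A point \<open>p\<close> of \<open>H\<close> nearest to \<open>z\<close> is a gate: for \<open>c\<close> in \<open>H\<close>, the median of \<open>z\<close>, \<open>c\<close> and \<open>p\<close>
belongs to \<open>H\<close> and lies between \<open>z\<close> and \<open>p\<close>. If it differed from \<open>p\<close>, it would be nearer to \<open>z\<close>.\<close>

lemma half_space_gate:
  assumes H: "half_space M m H" and "H \<noteq> {}" and z: "z \<in> M"
  obtains p where "p \<in> H" "\<And>c. c \<in> H \<Longrightarrow> p = m z c p"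
proof -
  obtain p where p: "p \<in> H" and min: "\<And>q. q \<in> H \<Longrightarrow> median_dist M m z p \<le> median_dist M m z q"
    using \<open>H \<noteq> {}\<close> arg_min_nat_lemma[of "\<lambda>q. q \<in> H" _ "median_dist M m z"] by blast
  have HM: "H \<subseteq> M" using H by (rule half_space_subset)
  have "p = m z c p" if c: "c \<in> H" for c
  proof (rule ccontr)
    assume neq: "p \<noteq> m z c p"
    let ?q = "m z c p"
    have M: "p \<in> M" "c \<in> M" "?q \<in> M" using p c HM z by (auto intro: closed)
    have "?q \<in> H" using half_space_median_iff[OF H z M(2,1)] p c by blast
    have "?q = m z p ?q"
      using M z by (metis median_between swap)
    then have "median_dist M m z p = median_dist M m z ?q + median_dist M m ?q p"
      using M z by (intro dist_between)
    moreover have "median_dist M m ?q p > 0" using M neq by (intro dist_pos) auto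
    ultimately show False using min[OF \<open>?q \<in> H\<close>] by linarith
  qed
  then show thesis using p that by blast
qed

text \<open>Suppose the centre is infinite, and let \<open>x\<close> be one of its points. Among the points \<open>z\<close> that lie
between \<open>x\<close> and infinitely many points of the centre, choose one as far from \<open>x\<close> as possible;
these distances are bounded because the centre has diameter at most \<open>2 * R\<close>. A half space that excludes \<open>z\<close>
then contains only finitely many of the points behind \<open>z\<close>, since otherwise its gate as seen from
\<open>z\<close> would be a better choice. So every \<open>b \<in> B\<close> is closer to \<open>z\<close> than to some point of the
centre, and \<open>z\<close> has a radius less than \<open>R\<close>.\<close>

lemma finite_centre:
  fixes R :: nat
  assumes B: "B \<subseteq> M" "B \<noteq> {}"
    and min: "\<And>K. K < R \<Longrightarrow> \<not> (\<exists>x\<in>M. \<forall>b\<in>B. median_dist M m x b \<le> K)"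
  shows "finite {x \<in> M. \<forall>b\<in>B. median_dist M m x b \<le> R}" (is "finite ?C")
proof (rule ccontr)
  assume inf: "infinite ?C"
  then obtain x where x: "x \<in> ?C" using infinite_imp_nonempty by blast
  define between where "between z = {c \<in> ?C. z = m x c z}" for z
  define Q where "Q n \<longleftrightarrow> (\<exists>z\<in>M. median_dist M m x z = n \<and> infinite (between z))" for n
  have xM: "x \<in> M" using x by simp
  have "between x = ?C" using xM by (auto simp: between_def majority')
  then have Q0: "Q (median_dist M m x x)" using xM inf by (auto simp: Q_def)
  have bound: "n \<le> 2 * R" if "Q n" for n
  proof -
    obtain z where z: "z \<in> M" "median_dist M m x z = n" "infinite (between z)"
      using \<open>Q n\<close> by (auto simp: Q_def)
    then obtain c where "c \<in> between z" using infinite_imp_nonempty by blast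
    then have c: "c \<in> M" "z = m x c z" "\<And>b. b \<in> B \<Longrightarrow> median_dist M m c b \<le> R"
      by (auto simp: between_def)
    obtain b where b: "b \<in> B" "b \<in> M" using B by blast
    have "median_dist M m x z + median_dist M m z c = median_dist M m x c"
      using dist_between[OF xM c(1) z(1) c(2)] by simp
    also have "\<dots> \<le> median_dist M m x b + median_dist M m b c"
      by (rule dist_triangle) (use xM c b in auto)
    also have "\<dots> \<le> R + R"
      using x c(3)[OF b(1)] b dist_sym[OF c(1) b(2)] by (intro add_mono) auto
    finally show ?thesis using z(2) by simp
  qed
  define n where "n = Greatest Q"
  have "Q n" unfolding n_def using Q0 bound by (rule GreatestI_nat)
  have max: "k \<le> n" if "Q k" for k
    unfolding n_def using that bound by (rule Greatest_le_nat)
  obtain z where z: "z \<in> M" "median_dist M m x z = n" "infinite (between z)"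
    using \<open>Q n\<close> by (auto simp: Q_def)
  have few: "finite (between z \<inter> H)" if H: "half_space M m H" "z \<notin> H" for H
  proof (rule ccontr)
    assume inf': "infinite (between z \<inter> H)"
    then have "H \<noteq> {}" by auto
    then obtain p where p: "p \<in> H" and gate: "\<And>c. c \<in> H \<Longrightarrow> p = m z c p"
      using half_space_gate[OF H(1) _ z(1)] by blast
    have pM: "p \<in> M" using p half_space_subset[OF H(1)] by blast
    have step: "p = m x c p \<and> z = m x p z" if c: "c \<in> between z \<inter> H" for c
    proof -
      have "c \<in> M" "z = m x c z" "p = m z c p" using c gate by (auto simp: between_def)
      then show ?thesis
        using interval_iff_half_spaces[of x c z] interval_iff_half_spaces[of z c p]
          interval_iff_half_spaces[of x c p] interval_iff_half_spaces[of x p z]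
          half_space_median_iff[of _ z c p] half_space_median_iff[of _ x c z] xM z(1) pM
        by auto
    qed
    obtain c where "c \<in> between z \<inter> H" using infinite_imp_nonempty[OF inf'] by blast
    then have "median_dist M m x p = n + median_dist M m z p"
      using dist_between[OF xM pM z(1)] step z(2) by auto
    moreover have "median_dist M m z p > 0" using z(1) pM p H(2) by (intro dist_pos) auto
    moreover have "between z \<inter> H \<subseteq> between p" using step by (auto simp: between_def)
    then have "infinite (between p)" using inf' finite_subset by blast
    then have "Q (median_dist M m x p)" using pM by (auto simp: Q_def)
    ultimately show False using max by fastforce
  qed
  have less: "median_dist M m z b < R" if b: "b \<in> B" for b
  proof -
    have bM: "b \<in> M" using b B by blast
    \<comment> \<open>The points behind \<open>z\<close> in a direction that also leads towards \<open>b\<close> are finite in number.\<close>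
    let ?E = "insert z (\<Union>H\<in>separating_half_spaces M m b z. between z \<inter> H)"
    have "finite ?E"
      unfolding finite_insert
      by (rule finite_UN_I[OF discrete[OF bM z(1)]]) (simp add: few separating_half_spaces_def)
    then obtain c where c: "c \<in> between z" "c \<notin> ?E"
      using z(3) by (meson finite_subset subsetI)
    have cM: "c \<in> M" and cR: "median_dist M m c b \<le> R"
      using c(1) b by (auto simp: between_def)
    have "z = m b c z"
      using c interval_iff_half_spaces[OF bM cM z(1)] by (auto simp: separating_half_spaces_def)
    then have "median_dist M m b c = median_dist M m b z + median_dist M m z c"
      using bM cM z(1) by (intro dist_between)
    moreover have "median_dist M m z c > 0" using c z(1) cM by (intro dist_pos) auto
    ultimately show ?thesis using cR dist_sym[OF bM cM] dist_sym[OF bM z(1)] by linarith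
  qed
  then have "R > 0" using B by fastforce
  then show False using min[of "R - 1"] less z(1) by fastforce
qed

end

section \<open>Median automorphisms\<close>

locale median_automorphism = median_algebra +
  fixes f
  assumes bij: "bij_betw f M M"
    and hom: "\<lbrakk>x \<in> M; y \<in> M; z \<in> M\<rbrakk> \<Longrightarrow> f (m x y z) = m (f x) (f y) (f z)"
begin

lemma map_closed: "x \<in> M \<Longrightarrow> f x \<in> M"
  using bij by (auto simp: bij_betw_def)

lemma map_eq_iff: "x \<in> M \<Longrightarrow> y \<in> M \<Longrightarrow> f x = f y \<longleftrightarrow> x = y"
  using bij by (auto simp: bij_betw_def inj_on_def)

lemma map_surj: "y \<in> M \<Longrightarrow> \<exists>x\<in>M. y = f x"
  using bij by (auto simp: bij_betw_def)

lemma mem_image_iff: "x \<in> M \<Longrightarrow> A \<subseteq> M \<Longrightarrow> f x \<in> f ` A \<longleftrightarrow> x \<in> A"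
  using map_eq_iff by blast

lemma image_Diff: "A \<subseteq> M \<Longrightarrow> f ` (M - A) = M - f ` A"
  using bij inj_on_image_set_diff[of f M M A] by (simp add: bij_betw_def)

lemma convex_image_iff:
  assumes "A \<subseteq> M"
  shows "median_convex M m (f ` A) \<longleftrightarrow> median_convex M m A"
proof -
  have int: "f ` median_interval M m x y = median_interval M m (f x) (f y)" if "x \<in> M" "y \<in> M" for x y
  proof
    show "f ` median_interval M m x y \<subseteq> median_interval M m (f x) (f y)"
    proof
      fix w assume "w \<in> f ` median_interval M m x y"
      then obtain z where z: "z \<in> M" "z = m x y z" "w = f z" by (auto simp: median_interval_def)
      have "f z = m (f x) (f y) (f z)" using hom[OF that z(1)] z(2) by simp
      then show "w \<in> median_interval M m (f x) (f y)"
        using z map_closed by (auto simp: median_interval_def)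
    qed
    show "median_interval M m (f x) (f y) \<subseteq> f ` median_interval M m x y"
    proof
      fix w assume w: "w \<in> median_interval M m (f x) (f y)"
      then obtain z where z: "z \<in> M" "w = f z" using map_surj by (auto simp: median_interval_def)
      have "f z = f (m x y z)" using w z hom[OF that z(1)] by (auto simp: median_interval_def)
      then have "z = m x y z" using map_eq_iff[OF z(1) closed[OF that z(1)]] by simp
      then show "w \<in> f ` median_interval M m x y" using z by (auto simp: median_interval_def)
    qed
  qed
  have "median_interval M m x y \<subseteq> M" for x y by (auto simp: median_interval_def)
  then have sub: "f ` median_interval M m x y \<subseteq> f ` A \<longleftrightarrow> median_interval M m x y \<subseteq> A" for x y
    using mem_image_iff[OF _ assms] by blast
  have fA: "f ` A \<subseteq> M" using assms map_closed by blast
  have "(\<forall>x\<in>A. \<forall>y\<in>A. median_interval M m (f x) (f y) \<subseteq> f ` A)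
      \<longleftrightarrow> (\<forall>x\<in>A. \<forall>y\<in>A. median_interval M m x y \<subseteq> A)"
    using int sub assms by (metis subsetD)
  then show ?thesis
    unfolding median_convex_def ball_simps using fA assms by blast
qed

lemma half_space_image_iff: "A \<subseteq> M \<Longrightarrow> half_space M m (f ` A) \<longleftrightarrow> half_space M m A"
  using convex_image_iff[of A] convex_image_iff[of "M - A"] map_closed
  by (auto simp: half_space_def image_Diff)

text \<open>An automorphism permutes the half spaces. The two predicates allow the same fact to be used
for half spaces related to a configuration and to its image.\<close>

lemma image_half_spaces:
  assumes "\<And>H. half_space M m H \<Longrightarrow> Q (f ` H) \<longleftrightarrow> P H"
  shows "(`) f ` {H. half_space M m H \<and> P H} = {H. half_space M m H \<and> Q H}"
proof
  show "(`) f ` {H. half_space M m H \<and> P H} \<subseteq> {H. half_space M m H \<and> Q H}"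
    using assms half_space_image_iff half_space_subset by auto
  show "{H. half_space M m H \<and> Q H} \<subseteq> (`) f ` {H. half_space M m H \<and> P H}"
  proof
    fix K assume "K \<in> {H. half_space M m H \<and> Q H}"
    then have K: "half_space M m K" "Q K" by auto
    let ?H = "{x \<in> M. f x \<in> K}"
    have "K = f ` ?H" using half_space_subset[OF K(1)] map_surj by blast
    moreover from this have "half_space M m ?H" using K(1) half_space_image_iff[of ?H] by simp
    ultimately show "K \<in> (`) f ` {H. half_space M m H \<and> P H}"
      using assms[of ?H] K(2) by auto
  qed
qed

lemma card_half_spaces_image:
  assumes "\<And>H. half_space M m H \<Longrightarrow> Q (f ` H) \<longleftrightarrow> P H"
  shows "card {H. half_space M m H \<and> Q H} = card {H. half_space M m H \<and> P H}"
proof -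
  have "inj_on f M" using bij by (simp add: bij_betw_def)
  then have "inj_on ((`) f) {H. half_space M m H \<and> P H}"
    by (intro inj_on_subset[OF inj_on_image_Pow]) (auto dest: half_space_subset)
  then show ?thesis using card_image image_half_spaces[of Q P] assms by metis
qed

lemma dist_map:
  assumes "x \<in> M" "y \<in> M"
  shows "median_dist M m (f x) (f y) = median_dist M m x y"
  unfolding median_dist_def separating_half_spaces_def
  by (rule card_half_spaces_image) (use assms in \<open>auto simp: mem_image_iff half_space_subset\<close>)

end

section \<open>The cube spanned by the equally deep half spaces\<close>

context median_algebra
begin

text \<open>Counting the half spaces inside \<open>H\<close>, rather than the points of \<open>C\<close> in \<open>H\<close>, makes the value
increase strictly with \<open>H\<close>. This is a finite number when \<open>C\<close> is finite and not contained
in \<open>H\<close>; the definition of \<open>heavy\<close> below therefore treats half spaces containing \<open>C\<close> separately.\<close>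

definition depth :: "'a set \<Rightarrow> 'a set \<Rightarrow> nat" where
  "depth C H = card {K. half_space M m K \<and> K \<subseteq> H \<and> K \<inter> C \<noteq> {}}"

definition splitting :: "'a set \<Rightarrow> 'a set set" where
  "splitting C = {H. half_space M m H \<and> H \<inter> C \<noteq> {} \<and> C - H \<noteq> {}}"

definition heavy :: "'a set \<Rightarrow> 'a set set" where
  "heavy C = {H. half_space M m H \<and>
     (C \<subseteq> H \<or> H \<in> splitting C \<and> depth C (M - H) < depth C H)}"

definition balanced :: "'a set \<Rightarrow> 'a set set" where
  "balanced C = {H \<in> splitting C. depth C (M - H) = depth C H}"

definition core :: "'a set \<Rightarrow> 'a set" where
  "core C = {x \<in> M. \<forall>H\<in>heavy C. x \<in> H}"

lemma convex_half_space_Inter: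
  assumes "\<And>H. H \<in> \<F> \<Longrightarrow> half_space M m H"
  shows "median_convex M m {x \<in> M. \<forall>H\<in>\<F>. x \<in> H}"
  unfolding median_convex_def
proof (intro conjI ballI subsetI)
  fix x y z
  assume xy: "x \<in> {x \<in> M. \<forall>H\<in>\<F>. x \<in> H}" "y \<in> {x \<in> M. \<forall>H\<in>\<F>. x \<in> H}"
    and z: "z \<in> median_interval M m x y"
  then have M: "x \<in> M" "y \<in> M" "z \<in> M" "z = m x y z" by (auto simp: median_interval_def)
  have "z \<in> H" if "H \<in> \<F>" for H
    using half_space_median_iff[OF assms[OF that] M(1-3)] M(4) xy that by auto
  then show "z \<in> {x \<in> M. \<forall>H\<in>\<F>. x \<in> H}" using M by simp
qed auto

lemma convex_core: "median_convex M m (core C)"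
  unfolding core_def by (rule convex_half_space_Inter) (simp add: heavy_def)

lemma splitting_compl:
  assumes "C \<subseteq> M" "H \<in> splitting C"
  shows "M - H \<in> splitting C"
  using assms half_space_compl by (auto simp: splitting_def)

lemma splitting_half_space: "H \<in> splitting C \<Longrightarrow> half_space M m H"
  by (simp add: splitting_def)

lemma splitting_subset: "H \<in> splitting C \<Longrightarrow> H \<subseteq> M"
  by (auto simp: splitting_def half_space_def)

lemma double_compl: "half_space M m H \<Longrightarrow> M - (M - H) = H"
  by (auto simp: half_space_def)

end

context discrete_median_algebra
begin

lemma finite_splitting:
  assumes "finite C" "C \<subseteq> M"
  shows "finite (splitting C)"
proof (rule finite_subset)
  show "splitting C \<subseteq> (\<Union>x\<in>C. \<Union>y\<in>C. separating_half_spaces M m x y)"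
    by (auto simp: splitting_def separating_half_spaces_def)
  show "finite (\<Union>x\<in>C. \<Union>y\<in>C. separating_half_spaces M m x y)"
    using assms discrete by (intro finite_UN_I) auto
qed

lemma depth_strict_mono:
  assumes C: "finite C" "C \<subseteq> M" and K: "K \<in> splitting C" and "H \<subset> K"
  shows "depth C H < depth C K"
  unfolding depth_def
proof (rule psubset_card_mono)
  have "{L. half_space M m L \<and> L \<subseteq> K \<and> L \<inter> C \<noteq> {}} \<subseteq> splitting C"
    using K by (auto simp: splitting_def)
  then show "finite {L. half_space M m L \<and> L \<subseteq> K \<and> L \<inter> C \<noteq> {}}"
    using finite_splitting[OF C] finite_subset by blast
  have "K \<in> {L. half_space M m L \<and> L \<subseteq> K \<and> L \<inter> C \<noteq> {}}"
    using K by (simp add: splitting_def)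
  moreover have "K \<notin> {L. half_space M m L \<and> L \<subseteq> H \<and> L \<inter> C \<noteq> {}}"
    using \<open>H \<subset> K\<close> by blast
  moreover have "{L. half_space M m L \<and> L \<subseteq> H \<and> L \<inter> C \<noteq> {}}
      \<subseteq> {L. half_space M m L \<and> L \<subseteq> K \<and> L \<inter> C \<noteq> {}}"
    using \<open>H \<subset> K\<close> by blast
  ultimately show "{L. half_space M m L \<and> L \<subseteq> H \<and> L \<inter> C \<noteq> {}}
      \<subset> {L. half_space M m L \<and> L \<subseteq> K \<and> L \<inter> C \<noteq> {}}"
    by blast
qed

text \<open>If \<open>H\<close> and \<open>K\<close> were disjoint, each would be properly contained in the complement of the other,
and strict monotonicity would give a cycle of inequalities between the four depths.\<close>

lemma deep_half_spaces_meet: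
  assumes C: "finite C" "C \<subseteq> M" and H: "H \<in> splitting C" and K: "K \<in> splitting C"
    and "depth C (M - H) \<le> depth C H" and "depth C (M - K) \<le> depth C K"
    and "H \<noteq> M - K"
  shows "H \<inter> K \<noteq> {}"
proof
  assume "H \<inter> K = {}"
  then have "H \<subset> M - K" "K \<subset> M - H"
    using \<open>H \<noteq> M - K\<close> splitting_subset[OF H] splitting_subset[OF K] by blast+
  then have "depth C H < depth C (M - K)" "depth C K < depth C (M - H)"
    using splitting_compl[OF C(2)] H K by (auto intro: depth_strict_mono[OF C])
  then show False using assms(5,6) by linarith
qed

text \<open>The half spaces that contain \<open>C\<close> may be infinite in number, so Helly's theorem is applied with
their intersection, the convex hull of \<open>C\<close>, as a single convex set. It meets every half space that
splits \<open>C\<close> because it contains \<open>C\<close>.\<close>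

lemma orientation_point:
  assumes C: "finite C" "C \<subseteq> M" "C \<noteq> {}" and \<O>: "\<O> \<subseteq> splitting C"
    and deep: "\<And>H. H \<in> \<O> \<Longrightarrow> depth C (M - H) \<le> depth C H"
    and consistent: "\<And>H. H \<in> \<O> \<Longrightarrow> M - H \<notin> \<O>"
  obtains x where "x \<in> M" "\<And>H. H \<in> \<O> \<Longrightarrow> x \<in> H"
    "\<And>H. half_space M m H \<Longrightarrow> C \<subseteq> H \<Longrightarrow> x \<in> H"
proof -
  let ?hull = "{x \<in> M. \<forall>H\<in>{H. half_space M m H \<and> C \<subseteq> H}. x \<in> H}"
  have CQ: "C \<subseteq> ?hull" using C by auto
  have "?hull \<inter> \<Inter>\<O> \<noteq> {}"
  proof (rule Helly)
    show "finite \<O>" using finite_splitting[OF C(1,2)] \<O> finite_subset by blast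
    show "median_convex M m ?hull" by (rule convex_half_space_Inter) simp
    show "?hull \<noteq> {}" using CQ C(3) by blast
  next
    fix H assume H: "H \<in> \<O>"
    then show "median_convex M m H" using \<O> by (auto simp: splitting_def half_space_def)
    have "H \<inter> C \<noteq> {}" using H \<O> by (auto simp: splitting_def)
    then show "?hull \<inter> H \<noteq> {}" using CQ by blast
  next
    fix H K assume "H \<in> \<O>" "K \<in> \<O>"
    then show "H \<inter> K \<noteq> {}"
      using \<O> deep consistent by (intro deep_half_spaces_meet[OF C(1,2)]) auto
  qed
  then show thesis using that by auto
qed

text \<open>Of the two sides of a half space, at least one belongs to \<open>heavy C\<close> unless the half space is
balanced, so only balanced half spaces can separate points of the core. The reference point \<open>c\<close>
selects one half space from each complementary pair.\<close>

lemma core_eqI: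
  assumes C: "C \<subseteq> M" "c \<in> C" and x: "x \<in> core C" and y: "y \<in> core C"
    and eq: "\<And>H. \<lbrakk>H \<in> balanced C; c \<in> H\<rbrakk> \<Longrightarrow> x \<in> H \<longleftrightarrow> y \<in> H"
  shows "x = y"
proof (rule half_spaces_eqI)
  show M: "x \<in> M" "y \<in> M" using x y by (auto simp: core_def)
  fix H assume H: "half_space M m H" and "x \<in> H"
  note H' = half_space_compl[OF H] double_compl[OF H] half_space_subset[OF H]
  show "y \<in> H"
  proof (cases "H \<in> splitting C")
    case False
    then have "H \<in> heavy C \<or> M - H \<in> heavy C"
      using H H' C by (auto simp: splitting_def heavy_def)
    then show ?thesis using x y \<open>x \<in> H\<close> by (auto simp: core_def)
  next
    case True
    then have compl: "M - H \<in> splitting C" by (rule splitting_compl[OF C(1)])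
    consider "depth C (M - H) < depth C H" | "depth C H < depth C (M - H)"
      | "depth C (M - H) = depth C H" by linarith
    then show ?thesis
    proof cases
      case 1
      then have "H \<in> heavy C" using H True by (simp add: heavy_def)
      then show ?thesis using y by (simp add: core_def)
    next
      case 2
      then have "M - H \<in> heavy C" using H' compl by (simp add: heavy_def)
      then show ?thesis using x \<open>x \<in> H\<close> by (auto simp: core_def)
    next
      case 3
      then have "H \<in> balanced C" "M - H \<in> balanced C"
        using True compl H' by (auto simp: balanced_def)
      then show ?thesis using eq[of H] eq[of "M - H"] \<open>x \<in> H\<close> M C by blast
    qed
  qed
qed

text \<open>Together with the strictly deeper sides, the members of \<open>A\<close> and the complements of the other
balanced half spaces around \<open>c\<close> form an orientation to which \<open>orientation_point\<close> applies.\<close>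

lemma core_realises:
  assumes C: "finite C" "C \<subseteq> M" "c \<in> C" and A: "A \<subseteq> {H \<in> balanced C. c \<in> H}"
  obtains x where "x \<in> core C" "{H \<in> balanced C. c \<in> H \<and> x \<in> H} = A"
proof -
  define \<O> where "\<O> = {H \<in> splitting C. depth C (M - H) < depth C H \<or>
    depth C (M - H) = depth C H \<and> (if c \<in> H then H \<in> A else M - H \<notin> A)}"
  have cM: "c \<in> M" using C by blast
  obtain x where x: "x \<in> M" "\<And>H. H \<in> \<O> \<Longrightarrow> x \<in> H"
    and hull: "\<And>H. half_space M m H \<Longrightarrow> C \<subseteq> H \<Longrightarrow> x \<in> H"
  proof (rule orientation_point)
    show "finite C" "C \<subseteq> M" "C \<noteq> {}" "\<O> \<subseteq> splitting C" using C by (auto simp: \<O>_def)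
    show "depth C (M - H) \<le> depth C H" if "H \<in> \<O>" for H using that by (auto simp: \<O>_def)
    show "M - H \<notin> \<O>" if "H \<in> \<O>" for H
    proof -
      have "M - (M - H) = H"
        using that by (intro double_compl) (auto simp: \<O>_def splitting_def)
      note dbl = this
      have H: "depth C (M - H) < depth C H \<or>
          depth C (M - H) = depth C H \<and> (if c \<in> H then H \<in> A else M - H \<notin> A)"
        using that unfolding \<O>_def by blast
      show ?thesis
      proof
        assume "M - H \<in> \<O>"
        then have "depth C H < depth C (M - H) \<or>
            depth C H = depth C (M - H) \<and> (if c \<in> M - H then M - H \<in> A else H \<notin> A)"
          unfolding \<O>_def mem_Collect_eq dbl by blast
        then show False using H cM by (cases "c \<in> H") auto
      qed
    qed
  qed blast
  have "x \<in> core C" using x hull by (auto simp: core_def heavy_def \<O>_def)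
  moreover have "x \<in> H \<longleftrightarrow> H \<in> A" if H: "H \<in> balanced C" "c \<in> H" for H
  proof
    have spl: "H \<in> splitting C" "M - H \<in> splitting C"
      and eq: "depth C (M - H) = depth C H" and dbl: "M - (M - H) = H"
      using H(1) splitting_compl[OF C(2)] double_compl splitting_half_space
      by (auto simp: balanced_def)
    show "x \<in> H" if "H \<in> A" using that spl eq H by (intro x(2)) (simp add: \<O>_def)
    show "H \<in> A" if "x \<in> H"
    proof (rule ccontr)
      assume "H \<notin> A"
      then have "M - H \<in> \<O>" using spl eq dbl H by (simp add: \<O>_def)
      then show False using x(2) \<open>x \<in> H\<close> by blast
    qed
  qed
  then have "{H \<in> balanced C. c \<in> H \<and> x \<in> H} = A" using A by blast
  ultimately show thesis using that by blast
qed

text \<open>The coordinates of a point of the core are the balanced half spaces around \<open>c\<close> that contain it: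
they determine the point by \<open>core_eqI\<close>, and are arbitrary by \<open>core_realises\<close>.\<close>

lemma core_isomorphic_Pow:
  assumes C: "finite C" "C \<subseteq> M" "c \<in> C"
  shows "median_isomorphic (core C) m (Pow {H \<in> balanced C. c \<in> H}) boolean_median"
proof -
  let ?U = "{H \<in> balanced C. c \<in> H}"
  let ?f = "\<lambda>x. {H \<in> balanced C. c \<in> H \<and> x \<in> H}"
  have inj: "inj_on ?f (core C)"
    by (rule inj_onI, rule core_eqI[OF C(2,3)]) blast+
  have image: "?f ` core C = Pow ?U"
  proof
    show "Pow ?U \<subseteq> ?f ` core C"
    proof
      fix A assume "A \<in> Pow ?U"
      then show "A \<in> ?f ` core C" using core_realises[OF C, of A] by blast
    qed
  qed blast
  have "?f (m x y z) = boolean_median (?f x) (?f y) (?f z)"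
    if "x \<in> core C" "y \<in> core C" "z \<in> core C" for x y z
  proof -
    have "x \<in> M" "y \<in> M" "z \<in> M" using that by (auto simp: core_def)
    then have "m x y z \<in> H \<longleftrightarrow> x \<in> H \<and> y \<in> H \<or> y \<in> H \<and> z \<in> H \<or> z \<in> H \<and> x \<in> H"
      if "H \<in> balanced C" for H
      using that by (intro half_space_median_iff) (auto simp: balanced_def splitting_def)
    then show ?thesis by (auto simp: boolean_median_def)
  qed
  then show ?thesis
    unfolding median_isomorphic_def bij_betw_def
    by (intro exI[of _ ?f] conjI ballI inj image)
qed

end

lemma boolean_median_isomorphic_nat:
  assumes "finite U" "median_isomorphic W m (Pow U) boolean_median"
  shows "\<exists>I :: nat set. finite I \<and> median_isomorphic W m (Pow I) boolean_median"
proof -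
  obtain g where g: "bij_betw g U {0..<card U}"
    using ex_bij_betw_finite_nat[OF assms(1)] by blast
  obtain f where f: "bij_betw f W (Pow U)"
    and hom: "\<And>x y z. \<lbrakk>x \<in> W; y \<in> W; z \<in> W\<rbrakk>
      \<Longrightarrow> f (m x y z) = boolean_median (f x) (f y) (f z)"
    using assms(2) unfolding median_isomorphic_def by blast
  have inj: "inj_on g U" using g by (simp add: bij_betw_def)
  have g_median: "g ` boolean_median a b c = boolean_median (g ` a) (g ` b) (g ` c)"
    if "a \<subseteq> U" "b \<subseteq> U" "c \<subseteq> U" for a b c
    using that by (simp add: boolean_median_def image_Un inj_on_image_Int[OF inj])
  have bij: "bij_betw ((`) g \<circ> f) W (Pow {0..<card U})"
    using f bij_betw_Pow[OF g] by (rule bij_betw_trans)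
  have "f x \<subseteq> U" if "x \<in> W" for x using f that by (auto simp: bij_betw_def)
  then have "((`) g \<circ> f) (m x y z)
      = boolean_median (((`) g \<circ> f) x) (((`) g \<circ> f) y) (((`) g \<circ> f) z)"
    if "x \<in> W" "y \<in> W" "z \<in> W" for x y z
    using that hom g_median by simp
  then have "median_isomorphic W m (Pow {0..<card U}) boolean_median"
    unfolding median_isomorphic_def by (intro exI[of _ "(`) g \<circ> f"] conjI ballI bij)
  then show ?thesis by (intro exI[of _ "{0..<card U}"]) simp
qed

context median_automorphism
begin

lemma image_eq_self:
  assumes "A \<subseteq> M" "\<And>x. x \<in> M \<Longrightarrow> f x \<in> A \<longleftrightarrow> x \<in> A"
  shows "f ` A = A"
proof
  show "f ` A \<subseteq> A" using assms by auto
  show "A \<subseteq> f ` A"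
  proof
    fix y assume "y \<in> A"
    moreover from this obtain x where "x \<in> M" "y = f x" using assms(1) map_surj by blast
    ultimately show "y \<in> f ` A" using assms(2) by simp
  qed
qed

text \<open>The core is defined from \<open>C\<close> and the half spaces alone, and an automorphism that preserves \<open>C\<close>
permutes the half spaces while preserving their depth.\<close>

lemma core_invariant:
  assumes C: "C \<subseteq> M" and fC: "f ` C = C"
  shows "f ` core C = core C"
proof -
  have inj: "inj_on f M" using bij by (simp add: bij_betw_def)
  have sub: "f ` A \<subseteq> f ` B \<longleftrightarrow> A \<subseteq> B" if "A \<subseteq> M" "B \<subseteq> M" for A B
    unfolding image_subset_iff using mem_image_iff[OF _ that(2)] that(1) by blast
  have meet: "f ` K \<inter> C = {} \<longleftrightarrow> K \<inter> C = {}" if "K \<subseteq> M" for K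
    using inj_on_image_Int[OF inj that C] fC by (metis image_is_empty)
  have over: "C \<subseteq> f ` K \<longleftrightarrow> C \<subseteq> K" if "K \<subseteq> M" for K
    using sub[OF C that] fC by simp
  have depth: "depth C (f ` H) = depth C H" if "H \<subseteq> M" for H
    unfolding depth_def
  proof (rule card_half_spaces_image)
    fix K assume "half_space M m K"
    then have K: "K \<subseteq> M" by (rule half_space_subset)
    then have "f ` K \<subseteq> f ` H \<longleftrightarrow> K \<subseteq> H"
      using sub[OF _ that] by simp
    then show "f ` K \<subseteq> f ` H \<and> f ` K \<inter> C \<noteq> {} \<longleftrightarrow> K \<subseteq> H \<and> K \<inter> C \<noteq> {}"
      using meet[OF K] by simp
  qed
  have heavy: "(`) f ` heavy C = heavy C"
    unfolding heavy_def
  proof (rule image_half_spaces)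
    fix H assume H: "half_space M m H"
    then have HM: "H \<subseteq> M" by (rule half_space_subset)
    have "f ` H \<in> splitting C \<longleftrightarrow> H \<in> splitting C"
      using H HM meet over by (simp add: splitting_def half_space_image_iff)
    moreover have "depth C (M - f ` H) = depth C (M - H)"
      using depth[of "M - H"] image_Diff[OF HM] by simp
    ultimately show "C \<subseteq> f ` H \<or> f ` H \<in> splitting C \<and> depth C (M - f ` H) < depth C (f ` H)
        \<longleftrightarrow> C \<subseteq> H \<or> H \<in> splitting C \<and> depth C (M - H) < depth C H"
      using over[OF HM] depth[OF HM] by simp
  qed
  have *: "(\<forall>H\<in>heavy C. y \<in> H) \<longleftrightarrow> (\<forall>H\<in>heavy C. y \<in> f ` H)" for y
    by (subst heavy[symmetric]) simp
  show ?thesis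
  proof (rule image_eq_self)
    show "core C \<subseteq> M" by (auto simp: core_def)
    fix x assume x: "x \<in> M"
    have "f x \<in> f ` H \<longleftrightarrow> x \<in> H" if "H \<in> heavy C" for H
      using that x by (intro mem_image_iff) (auto simp: heavy_def half_space_def)
    then show "f x \<in> core C \<longleftrightarrow> x \<in> core C"
      using *[of "f x"] x map_closed by (simp add: core_def)
  qed
qed

end

section \<open>The invariant cube\<close>

lemma (in median_action) median_automorphism:
  assumes "g \<in> carrier G"
  shows "median_automorphism M m (\<phi> g)"
proof
  show "bij_betw (\<phi> g) M M"
    using assms inj_prop surj_prop by (auto simp: bij_betw_def)
  show "\<phi> g (m x y z) = m (\<phi> g x) (\<phi> g y) (\<phi> g z)" if "x \<in> M" "y \<in> M" "z \<in> M" for x y z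
    using assms that by (rule automorphism)
qed

theorem theorem11p9:
  fixes G :: "('g, 'r) monoid_scheme"
    and M :: "'a set"
    and m :: "'a \<Rightarrow> 'a \<Rightarrow> 'a \<Rightarrow> 'a"
    and \<phi> :: "'g \<Rightarrow> 'a \<Rightarrow> 'a"
  assumes "discrete_median_algebra M m"
    and "median_action G M m \<phi>"
    and "\<exists>B. B \<noteq> {} \<and> G_subset G M \<phi> B \<and> median_bounded M m B"
  shows "\<exists>W. finite_G_cube G M m \<phi> W"
proof -
  interpret discrete_median_algebra M m by fact
  interpret action: median_action G M m \<phi> by fact
  obtain B where B: "B \<noteq> {}" "G_subset G M \<phi> B" "median_bounded M m B"
    using assms(3) by blast
  then have "B \<subseteq> M" and inv: "\<And>g. g \<in> carrier G \<Longrightarrow> \<phi> g ` B = B"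
    by (simp_all add: G_subset_def)
  obtain K where K: "\<And>x y. x \<in> B \<Longrightarrow> y \<in> B \<Longrightarrow> median_dist M m x y \<le> K"
    using B(3) unfolding median_bounded_def by meson
  define P where "P R \<longleftrightarrow> (\<exists>x\<in>M. \<forall>b\<in>B. median_dist M m x b \<le> R)" for R
  obtain b\<^sub>0 where "b\<^sub>0 \<in> B" using B(1) by blast
  then have "P K" unfolding P_def using \<open>B \<subseteq> M\<close> K by (intro bexI[of _ b\<^sub>0]) auto
  define R where "R = Least P"
  have "P R" unfolding R_def using \<open>P K\<close> by (rule LeastI)
  define C where "C = {x \<in> M. \<forall>b\<in>B. median_dist M m x b \<le> R}"
  have "finite C"
    unfolding C_def
  proof (rule finite_centre[OF \<open>B \<subseteq> M\<close> B(1)])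
    show "\<not> (\<exists>x\<in>M. \<forall>b\<in>B. median_dist M m x b \<le> k)" if "k < R" for k
      using not_less_Least[of k P] that unfolding R_def P_def by blast
  qed
  have "C \<subseteq> M" by (auto simp: C_def)
  obtain c where c: "c \<in> C" using \<open>P R\<close> by (auto simp: P_def C_def)
  note C = \<open>finite C\<close> \<open>C \<subseteq> M\<close> c
  have core: "\<phi> g ` core C = core C" if g: "g \<in> carrier G" for g
  proof -
    interpret median_automorphism M m "\<phi> g" by (rule action.median_automorphism[OF g])
    have "(\<forall>b\<in>B. median_dist M m (\<phi> g x) b \<le> R) \<longleftrightarrow> (\<forall>b\<in>B. median_dist M m x b \<le> R)"
      if "x \<in> M" for x
    proof -
      have "(\<forall>b\<in>B. median_dist M m (\<phi> g x) b \<le> R)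
          \<longleftrightarrow> (\<forall>b\<in>\<phi> g ` B. median_dist M m (\<phi> g x) b \<le> R)"
        using inv[OF g] by simp
      also have "\<dots> \<longleftrightarrow> (\<forall>b\<in>B. median_dist M m x b \<le> R)"
        using \<open>B \<subseteq> M\<close> that dist_map by (auto simp: subset_iff)
      finally show ?thesis .
    qed
    then have "\<phi> g ` C = C"
      using \<open>C \<subseteq> M\<close> map_closed by (intro image_eq_self) (simp_all add: C_def)
    then show ?thesis by (rule core_invariant[OF \<open>C \<subseteq> M\<close>])
  qed
  have iso: "median_isomorphic (core C) m (Pow {H \<in> balanced C. c \<in> H}) boolean_median"
    by (rule core_isomorphic_Pow[OF C])
  have "finite {H \<in> balanced C. c \<in> H}"
    using finite_splitting[OF C(1,2)] by (simp add: balanced_def)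
  then have "finite (core C)"
    using iso bij_betw_finite unfolding median_isomorphic_def by blast
  then have "finite_G_cube G M m \<phi> (core C)"
    using convex_core core boolean_median_isomorphic_nat[OF \<open>finite {H \<in> balanced C. c \<in> H}\<close> iso]
    by (auto simp: finite_G_cube_def G_subset_def core_def)
  then show ?thesis by blast
qed

end
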